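(* Let $\{x_1,x_2,x_3,\ldots\}$ and $\{y_1,y_2,y_3,\ldots\}$ be orthonormal systems in a separable complex Hilbert space $\mathcal{H}$ with inner product $\langle\cdot,\cdot\rangle_{\mathcal{H}}$. Then, for $0\le r<1$, we have the estimate \[ \sum_{l=2}^{+\infty}r^{2l}\bigg|\sum_{j,k:\,j+k=l}(jk)^{-\frac12}\langle x_j,y_k\rangle_{\mathcal{H}}\bigg|^2\le 2\log\frac{e}{1-r^2}. \]
   Context: The inner sum runs over pairs of positive integers $j,k$ with $j+k=l$. The inner product is sesquilinear (linear in the first variable, conjugate-linear in the second). *)

theory Defs
  imports "HOL-Analysis.Analysis"
begin

(* Complex inner product spaces. The inner product is linear in the first and
   conjugate-linear in the second argument. Building on real_normed_vector makes
   the topology and metric of the library those of the norm induced by cinner;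
   the real scalar multiplication is the restriction of the complex one. *)

class complex_inner = real_normed_vector +
  fixes scaleC :: "complex \<Rightarrow> 'a \<Rightarrow> 'a"
    and cinner :: "'a \<Rightarrow> 'a \<Rightarrow> complex"
  assumes scaleC_add_right: "scaleC a (x + y) = scaleC a x + scaleC a y"
    and scaleC_add_left: "scaleC (a + b) x = scaleC a x + scaleC b x"
    and scaleC_scaleC: "scaleC a (scaleC b x) = scaleC (a * b) x"
    and scaleC_one: "scaleC 1 x = x"
    and scaleR_eq_scaleC: "scaleR r x = scaleC (complex_of_real r) x"
    and cinner_commute: "cinner x y = cnj (cinner y x)"
    and cinner_add_left: "cinner (x + y) z = cinner x z + cinner y z"
    and cinner_scaleC_left: "cinner (scaleC a x) y = a * cinner x y"
    and cinner_self_nonneg: "0 \<le> Re (cinner x x)"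
    and cinner_self_eq_zero_iff: "cinner x x = 0 \<longleftrightarrow> x = 0"
    and norm_eq_sqrt_cinner: "norm x = sqrt (Re (cinner x x))"

class complex_hilbert_space = complex_inner + complete_space

definition orthonormal_on :: "'i set \<Rightarrow> ('i \<Rightarrow> 'a::complex_inner) \<Rightarrow> bool" where
  "orthonormal_on I x \<longleftrightarrow>
     (\<forall>i\<in>I. \<forall>j\<in>I. cinner (x i) (x j) = (if i = j then 1 else 0))"

end

theory Submission
  imports Defs
begin

text \<open>By Cauchy--Schwarz on the \<open>l - 1\<close> pairs with \<open>j + k = l\<close>, the \<open>l\<close>-th term is at most
  \<open>r^(2l)\<close> times the sum of \<open>l / (jk) |\<langle>x_j, y_k\<rangle>|^2\<close>. Since \<open>l / (jk) = 1/j + 1/k\<close>, the total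
  splits into two parts; in the part with weight \<open>1/j\<close> Bessel's inequality sums out \<open>k\<close>, in the other
  one it sums out \<open>j\<close>, and each part is bounded by the logarithmic series at \<open>r^2\<close>.\<close>

lemma cinner_add_right: "cinner x (y + z) = cinner x y + cinner x (z :: 'a::complex_inner)"
  by (metis cinner_add_left cinner_commute complex_cnj_add)

lemma cinner_diff_left: "cinner (x - y) z = cinner x z - cinner y (z :: 'a::complex_inner)"
  using cinner_add_left[of "x - y" y z] by simp

lemma cinner_diff_right: "cinner x (y - z) = cinner x y - cinner x (z :: 'a::complex_inner)"
  using cinner_add_right[of x "y - z" z] by simp

lemma cinner_zero_left: "cinner 0 (x :: 'a::complex_inner) = 0"
  using cinner_diff_left[of 0 0 x] by simp

lemma cinner_sum_left: "cinner (\<Sum>i\<in>I. f i) (x :: 'a::complex_inner) = (\<Sum>i\<in>I. cinner (f i) x)"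
  by (induction I rule: infinite_finite_induct) (auto simp: cinner_zero_left cinner_add_left)

text \<open>The vector \<open>p\<close> is the orthogonal projection of \<open>v\<close> onto the
  span of the \<open>y k\<close> with \<open>k\<close> in \<open>K\<close>, and the inner product of
  \<open>v - p\<close> with itself is \<open>cinner v v - S\<close>, which cannot be negative.
  Finite \<open>K\<close> is enough, since only partial sums are estimated later.\<close>

lemma Bessel_inequality:
  fixes y :: "'i \<Rightarrow> 'a::complex_inner"
  assumes y: "orthonormal_on I y" and K: "finite K" "K \<subseteq> I"
  shows "(\<Sum>k\<in>K. (cmod (cinner v (y k)))\<^sup>2) \<le> Re (cinner v v)"
proof -
  define c where "c k = cinner v (y k)" for k
  define p where "p = (\<Sum>k\<in>K. scaleC (c k) (y k))"
  define S where "S = (\<Sum>k\<in>K. (cmod (c k))\<^sup>2)"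
  have coeff: "cinner p (y i) = c i" if "i \<in> K" for i
  proof -
    have "cinner (y k) (y i) = (if k = i then 1 else 0)" if "k \<in> K" for k
      using y K(2) that \<open>i \<in> K\<close> by (simp add: orthonormal_on_def subset_iff)
    then have "cinner p (y i) = (\<Sum>k\<in>K. if k = i then c k else 0)"
      unfolding p_def cinner_sum_left cinner_scaleC_left
      by (intro sum.cong refl) simp
    with that K show ?thesis by simp
  qed
  \<comment> \<open>Pairing with \<open>p\<close> sees only the coefficients of \<open>z\<close>
    along the \<open>y k\<close>. Both \<open>v\<close> and \<open>p\<close> have the coefficients
    \<open>c k\<close>, so one computation serves for both.\<close>
  have left: "cinner p z = of_real S" if "\<And>k. k \<in> K \<Longrightarrow> cinner z (y k) = c k" for z
  proof -
    have "cinner p z = (\<Sum>k\<in>K. c k * cnj (cinner z (y k)))"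
      unfolding p_def cinner_sum_left cinner_scaleC_left
      by (subst cinner_commute) simp
    also have "\<dots> = of_real S"
      using that by (simp add: S_def complex_norm_square del: of_real_power)
    finally show ?thesis .
  qed
  have "cinner p v = of_real S" "cinner p p = of_real S"
    by (auto intro!: left simp: coeff c_def)
  moreover from this have "cinner v p = of_real S"
    by (subst cinner_commute) simp
  ultimately have "cinner (v - p) (v - p) = cinner v v - of_real S"
    by (simp add: cinner_diff_left cinner_diff_right)
  with cinner_self_nonneg[of "v - p"] show ?thesis
    by (simp add: S_def c_def)
qed

text \<open>The logarithmic series has nonnegative terms, so it dominates its partial sums. Its term
  at index 0 is \<open>x ^ 0 / 0 = 0\<close>.\<close>

lemma sum_power_over_index_le:
  fixes x :: real
  assumes "0 \<le> x" "x < 1"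
  shows "(\<Sum>j=1..N. x ^ j / real j) \<le> - ln (1 - x)"
proof -
  have "(\<lambda>n. x ^ n / real n) sums (- ln (1 - x))"
    using sums_minus[OF ln_series'[of "- x"]] assms by simp
  with assms show ?thesis
    by (intro order_trans[OF sum_le_suminf[of "\<lambda>n. x ^ n / real n" "{1..N}"]])
      (auto simp: sums_iff)
qed

text \<open>The antidiagonals are disjoint and, for \<open>l \<le> N\<close>, lie in the square.
  Passing to the square decouples \<open>j\<close> from \<open>k\<close>, so that each can be summed
  out alone.\<close>

lemma sum_over_antidiagonals_le:
  fixes f :: "nat \<times> nat \<Rightarrow> real"
  assumes "\<And>p. 0 \<le> f p"
  shows "(\<Sum>l\<le>N. \<Sum>p\<in>{(j, k). 1 \<le> j \<and> 1 \<le> k \<and> j + k = l}. f p) \<le>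
    (\<Sum>j=1..N. \<Sum>k=1..N. f (j, k))"
proof -
  have fin: "finite {(j, k). 1 \<le> j \<and> 1 \<le> k \<and> j + k = l}" for l :: nat
    by (rule finite_subset[of _ "{..l} \<times> {..l}"]) auto
  have "(\<Sum>l\<le>N. \<Sum>p\<in>{(j, k). 1 \<le> j \<and> 1 \<le> k \<and> j + k = l}. f p) =
      sum f (\<Union>l\<le>N. {(j, k). 1 \<le> j \<and> 1 \<le> k \<and> j + k = l})"
    using fin by (intro sum.UNION_disjoint[symmetric]) auto
  also have "\<dots> \<le> sum f ({1..N} \<times> {1..N})"
    using assms by (intro sum_mono2) auto
  finally show ?thesis
    by (simp add: sum.cartesian_product)
qed

lemma antidiagonal_Cauchy_Schwarz:
  fixes A :: "nat \<Rightarrow> nat \<Rightarrow> complex"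
  shows "(cmod (\<Sum>(j, k) \<in> {(j, k). 1 \<le> j \<and> 1 \<le> k \<and> j + k = l}.
      complex_of_real (real (j * k) powr (- 1 / 2)) * A j k))\<^sup>2 \<le>
    (\<Sum>(j, k) \<in> {(j, k). 1 \<le> j \<and> 1 \<le> k \<and> j + k = l}. (1 / j + 1 / k) * (cmod (A j k))\<^sup>2)"
    (is "(cmod (\<Sum>(j, k) \<in> ?D. ?t j k))\<^sup>2 \<le> _")
proof -
  have sub: "?D \<subseteq> (\<lambda>j. (j, l - j)) ` {1..l}"
    by auto
  have fin: "finite ?D"
    using finite_subset[OF sub] by simp
  have card: "card ?D \<le> l"
    using card_mono[OF _ sub] card_image_le[of "{1..l}" "\<lambda>j. (j, l - j)"] by simp
  have "(cmod (\<Sum>(j, k) \<in> ?D. ?t j k))\<^sup>2 \<le> (\<Sum>(j, k) \<in> ?D. cmod (?t j k))\<^sup>2"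
    by (intro power_mono) (auto intro: order_trans[OF norm_sum] simp: case_prod_unfold)
  also have "\<dots> \<le> card ?D * (\<Sum>(j, k) \<in> ?D. (cmod (?t j k))\<^sup>2)"
    using sum_squared_le_sum_of_squares[of "\<lambda>(j, k). cmod (?t j k)" ?D]
    by (simp add: case_prod_unfold mult.commute)
  \<comment> \<open>Rounding the number of pairs up to \<open>l = j + k\<close> is what turns the
    weight into exactly \<open>(j + k) / (j k) = 1 / j + 1 / k\<close>.\<close>
  also have "\<dots> \<le> real l * (\<Sum>(j, k) \<in> ?D. (cmod (?t j k))\<^sup>2)"
    using card by (intro mult_right_mono sum_nonneg) auto
  also have "\<dots> = (\<Sum>(j, k) \<in> ?D. (1 / j + 1 / k) * (cmod (A j k))\<^sup>2)"
    unfolding sum_distrib_left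
  proof (intro sum.cong refl, clarify)
    fix j k :: nat
    assume jk: "1 \<le> j" "1 \<le> k"
    define w where "w = (real (j * k) powr (- 1 / 2))\<^sup>2"
    have w: "w = 1 / (real j * real k)"
      using jk by (simp add: w_def powr_minus powr_half_sqrt power_divide inverse_eq_divide
          flip: minus_divide_left)
    have "(cmod (?t j k))\<^sup>2 = w * (cmod (A j k))\<^sup>2"
      by (simp add: w_def norm_mult power_mult_distrib)
    with jk show "real (j + k) * (cmod (?t j k))\<^sup>2 = (1 / j + 1 / k) * (cmod (A j k))\<^sup>2"
      by (simp add: w field_simps)
  qed
  finally show ?thesis .
qed

theorem corollary1p8p1:
  fixes x y :: "nat \<Rightarrow> 'a::complex_hilbert_space"
    and r :: real
  assumes separable: "separable_space (euclidean :: 'a topology)"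
    and orthonormal_x: "orthonormal_on {1..} x"
    and orthonormal_y: "orthonormal_on {1..} y"
    and r: "0 \<le> r" "r < 1"
  defines "a \<equiv> \<lambda>l. r ^ (2 * l) *
      (cmod (\<Sum>(j, k) \<in> {(j, k). 1 \<le> j \<and> 1 \<le> k \<and> j + k = l}.
        complex_of_real (real (j * k) powr (- 1 / 2)) * cinner (x j) (y k)))\<^sup>2"
  shows "a summable_on {2..} \<and>
    (\<Sum>\<^sub>\<infinity>l\<in>{2..}. a l) \<le> 2 * ln (exp 1 / (1 - r\<^sup>2))"
proof -
  define A where "A j k = (cmod (cinner (x j) (y k)))\<^sup>2" for j k
  define s where "s = r\<^sup>2"
  have s: "0 \<le> s" "s < 1"
    using r by (auto simp: s_def power_less_one_iff)
  have a_nonneg: "0 \<le> a l" for l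
    using r by (simp add: a_def)
  have row: "(\<Sum>k=1..N. A j k) \<le> 1" if "1 \<le> j" for j N
    using Bessel_inequality[OF orthonormal_y, of "{1..N}" "x j"] orthonormal_x that
    by (auto simp: A_def orthonormal_on_def)
  have column: "(\<Sum>j=1..N. A j k) \<le> 1" if "1 \<le> k" for k N
  proof -
    \<comment> \<open>Conjugation leaves the modulus unchanged, so Bessel also applies with the two
      systems exchanged.\<close>
    have "A j k = (cmod (cinner (y k) (x j)))\<^sup>2" for j
      unfolding A_def by (subst cinner_commute) simp
    then show ?thesis
      using Bessel_inequality[OF orthonormal_x, of "{1..N}" "y k"] orthonormal_y that
      by (auto simp: orthonormal_on_def)
  qed
  \<comment> \<open>Writing \<open>s ^ l\<close> as \<open>s ^ (j + k)\<close> inside the sum makes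
    the summand a function of the pair alone, ready for the passage to the square.\<close>
  have a_le: "a l \<le> (\<Sum>p\<in>{(j, k). 1 \<le> j \<and> 1 \<le> k \<and> j + k = l}.
      case p of (j, k) \<Rightarrow> s ^ (j + k) * ((1 / j + 1 / k) * A j k))" for l
  proof -
    have "a l \<le> s ^ l * (\<Sum>(j, k) \<in> {(j, k). 1 \<le> j \<and> 1 \<le> k \<and> j + k = l}. (1 / j + 1 / k) * A j k)"
      unfolding a_def A_def s_def power_mult[symmetric]
      using r by (intro mult_left_mono antidiagonal_Cauchy_Schwarz) auto
    also have "\<dots> = (\<Sum>p\<in>{(j, k). 1 \<le> j \<and> 1 \<le> k \<and> j + k = l}.
        case p of (j, k) \<Rightarrow> s ^ (j + k) * ((1 / j + 1 / k) * A j k))"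
      unfolding sum_distrib_left by (intro sum.cong) auto
    finally show ?thesis .
  qed
  have partial: "(\<Sum>l\<le>N. a l) \<le> - 2 * ln (1 - s)" for N
  proof -
    have "(\<Sum>l\<le>N. a l) \<le> (\<Sum>j=1..N. \<Sum>k=1..N. s ^ (j + k) * ((1 / j + 1 / k) * A j k))"
      using sum_over_antidiagonals_le[of "\<lambda>(j, k). s ^ (j + k) * ((1 / j + 1 / k) * A j k)" N] s
      by (intro order_trans[OF sum_mono[OF a_le]]) (auto simp: A_def)
    also have "\<dots> \<le> (\<Sum>j=1..N. \<Sum>k=1..N. s ^ j / j * A j k + s ^ k / k * A j k)"
    proof (intro sum_mono)
      fix j k :: nat
      \<comment> \<open>Each part drops the power of \<open>s\<close> in the variable that Bessel
        will sum out.\<close>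
      have "s ^ (j + k) / j \<le> s ^ j / j" "s ^ (j + k) / k \<le> s ^ k / k"
        using s by (intro divide_right_mono power_decreasing; simp)+
      then have "(s ^ (j + k) / j + s ^ (j + k) / k) * A j k \<le> (s ^ j / j + s ^ k / k) * A j k"
        by (intro mult_right_mono add_mono) (auto simp: A_def)
      then show "s ^ (j + k) * ((1 / j + 1 / k) * A j k) \<le> s ^ j / j * A j k + s ^ k / k * A j k"
        by (simp add: algebra_simps)
    qed
    also have "\<dots> = (\<Sum>j=1..N. s ^ j / j * (\<Sum>k=1..N. A j k)) + (\<Sum>k=1..N. s ^ k / k * (\<Sum>j=1..N. A j k))"
      unfolding sum.distrib sum_distrib_left by (subst (2) sum.swap) (rule refl)
    also have "\<dots> \<le> (\<Sum>j=1..N. s ^ j / j) + (\<Sum>k=1..N. s ^ k / k)"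
      using s row column by (intro add_mono sum_mono mult_left_le) auto
    also have "\<dots> \<le> - 2 * ln (1 - s)"
      using sum_power_over_index_le[OF s, of N] by simp
    finally show ?thesis .
  qed
  \<comment> \<open>The right-hand side is \<open>2 - 2 * ln (1 - s)\<close>, so there is room to
    spare.\<close>
  have "- 2 * ln (1 - s) \<le> 2 * ln (exp 1 / (1 - s))"
    using s by (simp add: ln_div)
  with partial have bound: "(\<Sum>l\<le>N. a l) \<le> 2 * ln (exp 1 / (1 - s))" for N
    by (rule order_trans)
  \<comment> \<open>For nonnegative terms, a common bound on all finite subsums gives both
    summability and the bound on the infinite sum.\<close>
  have finite_bound: "sum a F \<le> 2 * ln (exp 1 / (1 - s))" if fin: "finite F" for F
  proof -
    obtain N where "F \<subseteq> {..N}"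
      using fin finite_nat_iff_bounded_le by auto
    then have "sum a F \<le> (\<Sum>l\<le>N. a l)"
      using a_nonneg by (intro sum_mono2) auto
    also note bound
    finally show ?thesis .
  qed
  have "a summable_on {2..}"
    using a_nonneg finite_bound by (intro nonneg_bdd_above_summable_on bdd_aboveI2) auto
  moreover from this have "(\<Sum>\<^sub>\<infinity>l\<in>{2..}. a l) \<le> 2 * ln (exp 1 / (1 - s))"
    using finite_bound by (intro infsum_le_finite_sums) auto
  ultimately show ?thesis
    by (simp add: s_def)
qed

end
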